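(* Let $A$ be a Banach algebra and let $B$ be an abstract Segal algebra with respect to $A$. If $B$ is $\Delta$-weak character amenable, then so is $A$. Moreover, in the case that $B^2$ is dense in $B$ and $B$ has a bounded approximate identity, the converse is also valid: if $A$ is $\Delta$-weak character amenable, then so is $B$.
   Context: For a Banach algebra $A$, $\Delta(A)$ denotes the set of all nonzero characters (nonzero multiplicative linear functionals) on $A$. For $f\in A^*$ and $a\in A$, the functional $f.a\in A^*$ is defined by $(f.a)(b)=f(ab)$ for $b\in A$. For $\varphi\in\Delta(A)\cup\{0\}$, $A$ is called $\Delta$-weak $\varphi$-amenable if there exists $m\in A^{**}$ such that (1) $m(\varphi)=0$; and (2) $m(\psi.a)=\psi(a)$ for all $a\in A$ and all $\psi\in\Delta(A)\setminus\{\varphi\}$. $A$ is called $\Delta$-weak character amenable if it is $\Delta$-weak $\varphi$-amenable for every $\varphi\in\Delta(A)\cup\{0\}$. Let $(A,\|\cdot\|_A)$ be a Banach algebra. A Banach algebra $(B,\|\cdot\|_B)$ is an abstract Segal algebra with respect to $A$ if: (1) $B$ is a dense left ideal in $A$; (2) there exists $M>0$ such that $\|b\|_A\leq M\|b\|_B$ for all $b\in B$; (3) there exists $C>0$ such that $\|ab\|_B\leq C\|a\|_A\|b\|_B$ for all $a,b\in B$. $B^2$ denotes, as usual, the linear span of the products $bb'$ with $b,b'\in B$; the density of $B^2$ in $B$ and the bounded approximate identity of $B$ are with respect to $\|\cdot\|_B$. *)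

theory Defs
  imports "HOL-Analysis.Analysis"
begin

text \<open>Complex Banach algebras, not necessarily unital or commutative.  The library classes only
  provide real scalars; the class below adds a compatible complex scalar multiplication.\<close>

class complex_banach_algebra = real_normed_algebra + banach +
  fixes scaleC :: "complex \<Rightarrow> 'a \<Rightarrow> 'a"  (infixr "*\<^sub>C" 75)
  assumes scaleC_add_right: "c *\<^sub>C (x + y) = c *\<^sub>C x + c *\<^sub>C y"
    and scaleC_add_left: "(c + d) *\<^sub>C x = c *\<^sub>C x + d *\<^sub>C x"
    and scaleC_scaleC: "c *\<^sub>C (d *\<^sub>C x) = (c * d) *\<^sub>C x"
    and scaleR_scaleC: "r *\<^sub>R x = complex_of_real r *\<^sub>C x"
    and mult_scaleC_left: "(c *\<^sub>C x) * y = c *\<^sub>C (x * y)"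
    and mult_scaleC_right: "x * (c *\<^sub>C y) = c *\<^sub>C (x * y)"
    and norm_scaleC: "norm (c *\<^sub>C x) = cmod c * norm x"

lemma vector_space_scaleC:
  "vector_space (scaleC :: complex \<Rightarrow> 'a :: complex_banach_algebra \<Rightarrow> 'a)"
proof
  fix x :: 'a
  show "1 *\<^sub>C x = x"
    using scaleR_scaleC[of 1 x] by simp
qed (simp_all add: scaleC_add_right scaleC_add_left scaleC_scaleC)

instantiation complex :: complex_banach_algebra
begin

definition scaleC_complex :: "complex \<Rightarrow> complex \<Rightarrow> complex" where
  "scaleC_complex c x = c * x"

instance
  by standard (simp_all add: scaleC_complex_def algebra_simps scaleR_conv_of_real norm_mult)

end

text \<open>No continuity is required of a character (it is automatic on a Banach algebra).\<close>

definition characters :: "('a :: complex_banach_algebra \<Rightarrow> complex) set" where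
  "characters = {\<phi>. Vector_Spaces.linear scaleC (*) \<phi> \<and>
     (\<forall>a b. \<phi> (a * b) = \<phi> a * \<phi> b) \<and> \<phi> \<noteq> (\<lambda>_. 0)}"

definition dual :: "('a :: complex_banach_algebra \<Rightarrow> complex) set" where
  "dual = {f. Vector_Spaces.linear scaleC (*) f \<and> bounded_linear f}"

text \<open>An element of the second dual is represented by a function whose values outside
  \<^const>\<open>dual\<close> are irrelevant; \<^const>\<open>onorm\<close> is the norm of the dual space.\<close>

definition bidual :: "(('a :: complex_banach_algebra \<Rightarrow> complex) \<Rightarrow> complex) set" where
  "bidual = {m.
     (\<forall>f\<in>dual. \<forall>g\<in>dual. m (\<lambda>x. f x + g x) = m f + m g) \<and>
     (\<forall>c. \<forall>f\<in>dual. m (\<lambda>x. c * f x) = c * m f) \<and>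
     (\<exists>K. \<forall>f\<in>dual. cmod (m f) \<le> K * onorm f)}"

definition dual_act :: "('a :: complex_banach_algebra \<Rightarrow> complex) \<Rightarrow> 'a \<Rightarrow> 'a \<Rightarrow> complex" where
  "dual_act f a = (\<lambda>b. f (a * b))"

definition delta_weak_amenable :: "('a :: complex_banach_algebra \<Rightarrow> complex) \<Rightarrow> bool" where
  "delta_weak_amenable \<phi> \<longleftrightarrow>
     (\<exists>m\<in>bidual. m \<phi> = 0 \<and> (\<forall>a. \<forall>\<psi>\<in>characters - {\<phi>}. m (dual_act \<psi> a) = \<psi> a))"

definition delta_weak_character_amenable :: "'a :: complex_banach_algebra itself \<Rightarrow> bool" where
  "delta_weak_character_amenable _ \<longleftrightarrow>
     (\<forall>\<phi> \<in> characters \<union> {\<lambda>_::'a. 0}. delta_weak_amenable \<phi>)"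

text \<open>A subalgebra \<open>B\<close> of \<open>A\<close> with a norm of its own is given by a type \<open>'b\<close> together with the
  inclusion map \<open>\<iota>\<close>, an injective algebra homomorphism into \<open>'a\<close>; its range is \<open>B\<close> as a subset
  of \<open>A\<close>, and the norm of \<open>'b\<close> is the norm of \<open>B\<close>.  In the last condition \<open>c\<close> is the product
  \<open>ab\<close> as an element of \<open>B\<close>.\<close>

definition abstract_segal_algebra ::
    "('b :: complex_banach_algebra \<Rightarrow> 'a :: complex_banach_algebra) \<Rightarrow> bool" where
  "abstract_segal_algebra \<iota> \<longleftrightarrow>
     Vector_Spaces.linear scaleC scaleC \<iota> \<and> (\<forall>x y. \<iota> (x * y) = \<iota> x * \<iota> y) \<and> inj \<iota> \<and>
     closure (range \<iota>) = UNIV \<and> (\<forall>a b. a * \<iota> b \<in> range \<iota>) \<and>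
     (\<exists>M>0. \<forall>b. norm (\<iota> b) \<le> M * norm b) \<and>
     (\<exists>C>0. \<forall>a b c. \<iota> c = a * \<iota> b \<longrightarrow> norm c \<le> C * norm a * norm b)"

definition square_span :: "'b :: complex_banach_algebra set" where
  "square_span = module.span scaleC {x * y | x y. True}"

text \<open>A net in \<open>'b\<close> is a family \<open>e\<close> together with a proper filter on its index type, such as
  the filter of tails of a directed set.\<close>

definition bounded_approximate_identity ::
    "('i \<Rightarrow> 'b :: complex_banach_algebra) \<Rightarrow> 'i filter \<Rightarrow> bool" where
  "bounded_approximate_identity e F \<longleftrightarrow>
     F \<noteq> bot \<and> bounded (range e) \<and>
     (\<forall>b. ((\<lambda>i. e i * b) \<longlongrightarrow> b) F \<and> ((\<lambda>i. b * e i) \<longlongrightarrow> b) F)"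

end

(* A character psi satisfies psi.a = psi(a) psi, so Delta-weak phi-amenability only asks for a
   bounded functional m on the dual with m(phi) = 0 and m(psi) = 1 for all other characters psi.
   Since characters are continuous, composition with a continuous homomorphism of dense range is
   injective on characters and maps characters to characters, so such functionals push forward
   along it.  Applied to the inclusion of B into A this gives the first claim.  If B has a bounded
   approximate identity e, the bound of the norm of b e_i in B by C |b|_A |e_i|_B makes the two
   norms equivalent on B; hence B is closed in A, so B = A, and the inverse of the inclusion gives
   the converse. *)

theory Submission
  imports Defs
begin

lemma bounded_linear_of_linear_scaleC:
  fixes T :: "'b :: complex_banach_algebra \<Rightarrow> 'a :: complex_banach_algebra"
  assumes "Vector_Spaces.linear scaleC scaleC T" and "\<And>x. norm (T x) \<le> K * norm x"
  shows "bounded_linear T"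
  using assms
  by (intro bounded_linear_intro[where K = K])
    (simp_all add: Vector_Spaces.linear_iff scaleR_scaleC mult.commute)

lemma dual_compose:
  assumes "f \<in> dual" and "Vector_Spaces.linear scaleC scaleC T" and "bounded_linear T"
  shows "(\<lambda>x. f (T x)) \<in> dual"
  using assms by (auto simp: dual_def Vector_Spaces.linear_iff intro: bounded_linear_compose)

text \<open>If \<open>norm a\<close> were smaller than \<open>cmod (\<phi> a)\<close>, rescaling
  \<open>a\<close> would give \<open>u\<close> with \<open>norm u < 1\<close> and
  \<open>\<phi> u = 1\<close>. A solution of \<open>u + u * x = x\<close> is then impossible, since
  applying \<open>\<phi>\<close> yields 1 + \<open>\<phi> x\<close> =
  \<open>\<phi> x\<close>.\<close>

lemma character_norm_le:
  fixes a :: "'a :: complex_banach_algebra"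
  assumes "\<phi> \<in> characters"
  shows "cmod (\<phi> a) \<le> norm a"
proof (rule ccontr)
  assume less: "\<not> cmod (\<phi> a) \<le> norm a"
  have add: "\<And>x y. \<phi> (x + y) = \<phi> x + \<phi> y" and scale: "\<And>c x. \<phi> (c *\<^sub>C x) = c * \<phi> x"
    and mult: "\<And>x y. \<phi> (x * y) = \<phi> x * \<phi> y"
    using assms by (auto simp: characters_def Vector_Spaces.linear_iff)
  define u where "u = (1 / \<phi> a) *\<^sub>C a"
  have pos: "0 < cmod (\<phi> a)"
    using less norm_ge_zero[of a] by linarith
  have u1: "\<phi> u = 1"
    using pos by (auto simp: u_def scale)
  have "norm u < 1"
    using less pos by (simp add: u_def norm_scaleC norm_divide)
  moreover have "dist (u + u * x) (u + u * y) \<le> norm u * dist x y" for x y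
    by (simp add: dist_norm right_diff_distrib[symmetric] norm_mult_ineq)
  \<comment> \<open>The fixed point of this contraction is the sum of the powers \<open>u^n\<close>
    with n \<ge> 1; it stands in for the inverse of 1 - \<open>u\<close>, as the algebra may have no
    unit.\<close>
  ultimately obtain x where "u + u * x = x"
    using banach_fix_type[of "norm u" "\<lambda>x. u + u * x"] by auto
  then have "\<phi> u + \<phi> u * \<phi> x = \<phi> x"
    by (metis add mult)
  then show False
    by (simp add: u1)
qed

lemma characters_subset_dual: "characters \<subseteq> dual"
proof
  fix \<phi> :: "'a :: complex_banach_algebra \<Rightarrow> complex"
  assume \<phi>: "\<phi> \<in> characters"
  then have "bounded_linear \<phi>"
    using character_norm_le[OF \<phi>]
    by (intro bounded_linear_intro[where K = 1])
      (auto simp: characters_def Vector_Spaces.linear_iff scaleR_scaleC scaleR_conv_of_real scaleC_complex_def)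
  with \<phi> show "\<phi> \<in> dual"
    by (simp add: characters_def dual_def)
qed

lemma zero_in_dual: "(\<lambda>_. 0) \<in> dual"
  by (simp add: dual_def Vector_Spaces.linear_iff vector_space_scaleC)
    (simp add: vector_space_def algebra_simps)

lemma dual_eq_on_dense:
  assumes "f \<in> dual" "g \<in> dual" "closure S = UNIV" "\<And>x. x \<in> S \<Longrightarrow> f x = g x"
  shows "f = g"
proof
  fix x
  have "bounded_linear f" "bounded_linear g"
    using assms(1,2) by (simp_all add: dual_def)
  then have "continuous_on UNIV (\<lambda>x. f x - g x)"
    by (intro linear_continuous_on bounded_linear_sub)
  then have "f x - g x = 0"
    using continuous_constant_on_closure[of S "\<lambda>x. f x - g x" 0 x] assms(3,4) by simp
  then show "f x = g x" by simp
qed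

lemma delta_weak_amenable_iff:
  "delta_weak_amenable \<phi> \<longleftrightarrow> (\<exists>m\<in>bidual. m \<phi> = 0 \<and> (\<forall>\<psi>\<in>characters - {\<phi>}. m \<psi> = 1))"
proof -
  have "(\<forall>a. m (dual_act \<psi> a) = \<psi> a) \<longleftrightarrow> m \<psi> = 1"
    if m: "m \<in> bidual" and \<psi>: "\<psi> \<in> characters" for m and \<psi> :: "'a \<Rightarrow> complex"
  proof -
    have "dual_act \<psi> a = (\<lambda>x. \<psi> a * \<psi> x)" for a
      using \<psi> by (simp add: dual_act_def characters_def)
    \<comment> \<open>Elements of \<open>bidual\<close> are homogeneous on \<open>dual\<close> only,
      so pulling the scalar \<open>\<psi> a\<close> out of \<open>m\<close> rests on the continuity
      of characters.\<close>
    moreover have "\<psi> \<in> dual"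
      using \<psi> characters_subset_dual by blast
    ultimately have eq: "m (dual_act \<psi> a) = \<psi> a * m \<psi>" for a
      using m by (simp add: bidual_def)
    \<comment> \<open>At such a point the factor \<open>\<psi> a\<close> cancels from
      \<open>\<psi> a * m \<psi> = \<psi> a\<close>.\<close>
    have "\<exists>a. \<psi> a \<noteq> 0"
      using \<psi> by (auto simp: characters_def)
    then obtain a where "\<psi> a \<noteq> 0" ..
    then show ?thesis
      by (auto simp: eq)
  qed
  then show ?thesis
    unfolding delta_weak_amenable_def by (intro bex_cong refl) blast
qed

text \<open>This functional is the image of \<open>m\<close> under the second adjoint of
  \<open>T\<close>; its norm is controlled by that of \<open>m\<close> times
  \<open>onorm T\<close>.\<close>

lemma bidual_push_forward:
  fixes T :: "'b :: complex_banach_algebra \<Rightarrow> 'a :: complex_banach_algebra"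
  assumes m: "m \<in> bidual"
    and lin: "Vector_Spaces.linear scaleC scaleC T" and bl: "bounded_linear T"
  shows "(\<lambda>f. m (\<lambda>x. f (T x))) \<in> bidual"
proof -
  note comp = dual_compose[OF _ lin bl]
  obtain K where K: "\<And>f. f \<in> dual \<Longrightarrow> cmod (m f) \<le> K * onorm f"
    using m unfolding bidual_def by blast
  \<comment> \<open>The definition of \<open>bidual\<close> does not fix the sign of
    \<open>K\<close>; the absolute value makes multiplication by it monotone.\<close>
  have "cmod (m (\<lambda>x. f (T x))) \<le> (\<bar>K\<bar> * onorm T) * onorm f" if f: "f \<in> dual" for f
  proof -
    have fl: "bounded_linear f"
      using f by (simp add: dual_def)
    have "cmod (m (\<lambda>x. f (T x))) \<le> K * onorm (\<lambda>x. f (T x))"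
      by (rule K[OF comp[OF f]])
    also have "\<dots> \<le> \<bar>K\<bar> * onorm (\<lambda>x. f (T x))"
      by (intro mult_right_mono onorm_pos_le bounded_linear_compose[OF fl bl]) simp
    also have "\<dots> \<le> \<bar>K\<bar> * (onorm f * onorm T)"
      using onorm_compose[OF fl bl] by (intro mult_left_mono) (simp_all add: o_def)
    finally show ?thesis
      by (simp add: mult_ac)
  qed
  moreover have "m (\<lambda>x. f (T x) + g (T x)) = m (\<lambda>x. f (T x)) + m (\<lambda>x. g (T x))"
    "m (\<lambda>x. c * f (T x)) = c * m (\<lambda>x. f (T x))" if "f \<in> dual" "g \<in> dual" for f g c
    using m comp[OF that(1)] comp[OF that(2)] by (simp_all add: bidual_def)
  ultimately show ?thesis
    unfolding bidual_def by blast
qed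

lemma delta_weak_character_amenable_dense_range:
  fixes T :: "'b :: complex_banach_algebra \<Rightarrow> 'a :: complex_banach_algebra"
  assumes lin: "Vector_Spaces.linear scaleC scaleC T" and mult: "\<And>x y. T (x * y) = T x * T y"
    and bl: "bounded_linear T" and dense: "closure (range T) = UNIV"
    and amen: "delta_weak_character_amenable TYPE('b)"
  shows "delta_weak_character_amenable TYPE('a)"
proof -
  let ?R = "\<lambda>f x. f (T x)"
  have inj: "f = g" if "f \<in> dual" "g \<in> dual" "?R f = ?R g" for f g :: "'a \<Rightarrow> complex"
    using that by (intro dual_eq_on_dense[OF _ _ dense]) (auto dest: fun_cong)
  have char: "?R \<psi> \<in> characters" if \<psi>: "\<psi> \<in> characters" for \<psi> :: "'a \<Rightarrow> complex"
  proof -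
    have "\<psi> \<in> dual"
      using \<psi> characters_subset_dual by blast
    \<comment> \<open>Comparison with the zero functional: if \<open>\<psi>\<close> vanished on the
      dense range of \<open>T\<close>, it would vanish everywhere.\<close>
    then have "?R \<psi> \<in> dual" "?R \<psi> \<noteq> (\<lambda>_. 0)"
      using dual_compose[OF _ lin bl] inj[OF _ zero_in_dual] \<psi> by (auto simp: characters_def)
    then show ?thesis
      using \<psi> by (simp add: characters_def dual_def mult)
  qed
  have "delta_weak_amenable \<phi>" if \<phi>: "\<phi> \<in> characters \<union> {\<lambda>_. 0}" for \<phi> :: "'a \<Rightarrow> complex"
  proof -
    have "?R \<phi> \<in> characters \<union> {\<lambda>_. 0}"
      using \<phi> char by auto
    then obtain m where m: "m \<in> bidual" "m (?R \<phi>) = 0"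
      "\<And>\<psi>. \<psi> \<in> characters - {?R \<phi>} \<Longrightarrow> m \<psi> = 1"
      using amen by (auto simp: delta_weak_character_amenable_def delta_weak_amenable_iff)
    \<comment> \<open>Distinct functionals stay distinct after composition with \<open>T\<close>, so
      \<open>?R \<psi>\<close> is not the exceptional functional \<open>?R \<phi>\<close>. This
      covers \<phi> = 0 too.\<close>
    have "m (?R \<psi>) = 1" if \<psi>: "\<psi> \<in> characters - {\<phi>}" for \<psi>
    proof (rule m(3))
      have "\<phi> \<in> dual" "\<psi> \<in> dual"
        using \<phi> \<psi> characters_subset_dual zero_in_dual by auto
      then show "?R \<psi> \<in> characters - {?R \<phi>}"
        using inj \<psi> char by blast
    qed
    with m(2) show ?thesis
      unfolding delta_weak_amenable_iff
      by (intro bexI[OF _ bidual_push_forward[OF m(1) lin bl]]) simp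
  qed
  then show ?thesis
    by (simp add: delta_weak_character_amenable_def)
qed

lemma norm_le_of_bounded_approximate_identity:
  fixes \<iota> :: "'b :: complex_banach_algebra \<Rightarrow> 'a :: complex_banach_algebra"
    and e :: "'i \<Rightarrow> 'b"
  assumes mult: "\<And>x y. \<iota> (x * y) = \<iota> x * \<iota> y"
    and C: "0 < C" "\<And>a b c. \<iota> c = a * \<iota> b \<Longrightarrow> norm c \<le> C * norm a * norm b"
    and bai: "bounded_approximate_identity e F"
  obtains L where "0 < L" "\<And>b. norm b \<le> L * norm (\<iota> b)"
proof -
  obtain K where K: "0 < K" "\<And>i. norm (e i) \<le> K"
    using bai by (auto simp: bounded_approximate_identity_def bounded_pos)
  have "norm b \<le> (C * K) * norm (\<iota> b)" for b
  proof (rule tendsto_upperbound)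
    show "((\<lambda>i. norm (b * e i)) \<longlongrightarrow> norm b) F" "F \<noteq> bot"
      using bai by (auto simp: bounded_approximate_identity_def intro: tendsto_norm)
    have "norm (b * e i) \<le> (C * K) * norm (\<iota> b)" for i
    proof -
      have "norm (b * e i) \<le> C * norm (\<iota> b) * norm (e i)"
        \<comment> \<open>The Segal inequality is used with \<open>\<iota> b\<close> as the left
          factor, which is what brings in the norm of \<open>b\<close> in the larger
          algebra.\<close>
        by (rule C(2)) (rule mult)
      also have "\<dots> \<le> C * norm (\<iota> b) * K"
        using C(1) K(2) by (intro mult_left_mono) auto
      finally show ?thesis
        by (simp add: mult_ac)
    qed
    then show "\<forall>\<^sub>F i in F. norm (b * e i) \<le> (C * K) * norm (\<iota> b)"
      by simp
  qed
  with C(1) K(1) show thesis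
    by (intro that[of "C * K"]) auto
qed

theorem theorem4p2:
  fixes \<iota> :: "'b :: complex_banach_algebra \<Rightarrow> 'a :: complex_banach_algebra"
  assumes "abstract_segal_algebra \<iota>"
  shows "(delta_weak_character_amenable TYPE('b) \<longrightarrow> delta_weak_character_amenable TYPE('a)) \<and>
    (closure (square_span :: 'b set) = UNIV \<and>
     (\<exists>(e :: 'i \<Rightarrow> 'b) F. bounded_approximate_identity e F) \<longrightarrow>
     delta_weak_character_amenable TYPE('a) \<longrightarrow> delta_weak_character_amenable TYPE('b))"
proof -
  obtain M C where lin: "Vector_Spaces.linear scaleC scaleC \<iota>"
    and mult: "\<And>x y. \<iota> (x * y) = \<iota> x * \<iota> y"
    and inj: "inj \<iota>" and dense: "closure (range \<iota>) = UNIV"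
    and M: "\<And>b. norm (\<iota> b) \<le> M * norm b"
    and C: "0 < C" "\<And>a b c. \<iota> c = a * \<iota> b \<Longrightarrow> norm c \<le> C * norm a * norm b"
    using assms unfolding abstract_segal_algebra_def by blast
  have bl: "bounded_linear \<iota>"
    by (rule bounded_linear_of_linear_scaleC[OF lin M])
  have "delta_weak_character_amenable TYPE('b)"
    if bai: "bounded_approximate_identity e F" and amen: "delta_weak_character_amenable TYPE('a)"
    for e :: "'i \<Rightarrow> 'b" and F
  proof -
    obtain L where L: "0 < L" "\<And>b. norm b \<le> L * norm (\<iota> b)"
      using norm_le_of_bounded_approximate_identity[OF mult C bai] by blast
    \<comment> \<open>\<open>\<iota>\<close> is bounded below by 1 / \<open>L\<close> on a complete
      space, so its range is complete, hence closed; being dense, it is everything.\<close>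
    have "complete (range \<iota>)"
    proof (rule complete_isometric_image[OF _ subspace_UNIV bl _ complete_UNIV])
      show "0 < 1 / L" "\<forall>x\<in>UNIV. 1 / L * norm x \<le> norm (\<iota> x)"
        using L by (simp_all add: field_simps)
    qed
    then have surj: "surj \<iota>"
      using dense complete_imp_closed closure_closed by blast
    let ?T = "inv \<iota>"
    have \<iota>T: "\<iota> (?T x) = x" for x
      by (rule surj_f_inv_f[OF surj])
    have T_eq: "?T x = y" if "\<iota> y = x" for x y
      using that inv_f_f[OF inj] by auto
    have linT: "Vector_Spaces.linear scaleC scaleC ?T"
      using lin by (auto simp: Vector_Spaces.linear_iff \<iota>T intro!: T_eq)
    show ?thesis
    proof (rule delta_weak_character_amenable_dense_range[OF linT _ _ _ amen])
      show "?T (x * y) = ?T x * ?T y" for x y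
        by (rule T_eq) (simp add: mult \<iota>T)
      \<comment> \<open>The estimate by \<open>L\<close>, read at \<open>?T x\<close>, bounds the
        inverse.\<close>
      show "bounded_linear ?T"
        using L(2)[of "?T _"] by (intro bounded_linear_of_linear_scaleC[OF linT]) (simp add: \<iota>T)
      show "closure (range ?T) = UNIV"
        by (simp add: inj_imp_surj_inv inj)
    qed
  qed
  then show ?thesis
    using delta_weak_character_amenable_dense_range[OF lin mult bl dense] by blast
qed

end
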